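(* For all integers $n\geq 2$ and $m\geq 1$ we have $$\xi_{n,m}\leq 1-\frac{m-1}{n^{\lceil\log_n m\rceil}}.$$
   Context: Let $X$ be a finite alphabet with $n\ge 2$ letters. A code with length distribution $L=(a_1,\ldots,a_m)$, where the $a_i$ are positive integers, is a finite sequence $(v_1,\ldots,v_m)$ of words $v_i\in X^*$ with $|v_i|=a_i$ for all $i$. A code is a prefix code if it is an injective sequence of non-empty words such that no $v_i$ is a prefix (initial segment) of another code word $v_j$, $j\ne i$. A code $(v_1,\ldots,v_m)$ is uniquely decodable if $v_{i_1}v_{i_2}\cdots v_{i_t}=v_{j_1}v_{j_2}\cdots v_{j_{t'}}$ with $t,t'\geq 1$ and all indices in $\{1,\ldots,m\}$ implies $t=t'$ and $i_s=j_s$ for every $1\leq s\leq t$. $UD_n(L)$ denotes the set of uniquely decodable codes over an $n$-letter alphabet with length distribution $L$, and $PR_n(L)\subseteq UD_n(L)$ the subset of prefix codes. $\mathcal{L}_{n,m}$ is the set of sequences $L$ of positive integers of length $|L|=m$ with $UD_n(L)\neq\emptyset$ (equivalently, by Kraft-McMillan, $PR_n(L)\ne\emptyset$, equivalently $\sum_{i=1}^m n^{-a_i}\leq 1$). Define $$\xi_{n,m}:=\inf_{L\in\mathcal{L}_{n,m}}\frac{|PR_n(L)|}{|UD_n(L)|}.$$ *)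

theory Defs
  imports Complex_Main "HOL-Library.Sublist"
begin

definition codes :: "'a set \<Rightarrow> nat list \<Rightarrow> 'a list list set" where
  "codes X L = {v. length v = length L \<and>
     (\<forall>i<length L. v ! i \<in> lists X \<and> length (v ! i) = L ! i)}"

definition prefix_code :: "'a list list \<Rightarrow> bool" where
  "prefix_code v \<longleftrightarrow> distinct v \<and> [] \<notin> set v \<and>
     (\<forall>i<length v. \<forall>j<length v. i \<noteq> j \<longrightarrow> \<not> prefix (v ! i) (v ! j))"

text \<open>The sequences \<open>is\<close> and \<open>js\<close> of code word indices are lists, with indices counted from \<open>0\<close>.\<close>

definition uniquely_decodable :: "'a list list \<Rightarrow> bool" where
  "uniquely_decodable v \<longleftrightarrow>
     (\<forall>is js. is \<noteq> [] \<longrightarrow> js \<noteq> [] \<longrightarrow>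
        set is \<subseteq> {..<length v} \<longrightarrow> set js \<subseteq> {..<length v} \<longrightarrow>
        concat (map (\<lambda>i. v ! i) is) = concat (map (\<lambda>j. v ! j) js) \<longrightarrow> is = js)"

definition UD :: "'a set \<Rightarrow> nat list \<Rightarrow> 'a list list set" where
  "UD X L = {v \<in> codes X L. uniquely_decodable v}"

definition PR :: "'a set \<Rightarrow> nat list \<Rightarrow> 'a list list set" where
  "PR X L = {v \<in> codes X L. prefix_code v}"

definition length_dists :: "'a set \<Rightarrow> nat \<Rightarrow> nat list set" where
  "length_dists X m = {L. length L = m \<and> (\<forall>a\<in>set L. 0 < a) \<and> UD X L \<noteq> {}}"

definition xi :: "'a set \<Rightarrow> nat \<Rightarrow> real" where
  "xi X m = (INF L\<in>length_dists X m. real (card (PR X L)) / real (card (UD X L)))"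

lemma finite_codes:
  assumes "finite X"
  shows "finite (codes X L)"
proof -
  let ?W = "{w. set w \<subseteq> X \<and> length w \<le> Max (set L)}"
  have "codes X L \<subseteq> {v. set v \<subseteq> ?W \<and> length v = length L}"
  proof
    fix v assume v: "v \<in> codes X L"
    have "w \<in> ?W" if "w \<in> set v" for w
    proof -
      obtain i where "i < length L" "w = v ! i"
        using v \<open>w \<in> set v\<close> by (auto simp: codes_def in_set_conv_nth)
      then have "w \<in> lists X" "length w \<in> set L"
        using v by (auto simp: codes_def)
      then show ?thesis
        by (simp add: in_lists_conv_set subset_iff)
    qed
    then show "v \<in> {v. set v \<subseteq> ?W \<and> length v = length L}"
      using v by (auto simp: codes_def)
  qed
  moreover have "finite {v. set v \<subseteq> ?W \<and> length v = length L}"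
    by (intro finite_lists_length_eq finite_lists_length_le assms)
  ultimately show ?thesis
    by (rule finite_subset)
qed

lemma prefix_code_imp_uniquely_decodable:
  assumes "prefix_code v"
  shows "uniquely_decodable v"
proof -
  have ne: "v ! i \<noteq> []" if "i < length v" for i
    using assms that unfolding prefix_code_def by (metis nth_mem)
  have *: "set is \<subseteq> {..<length v} \<Longrightarrow> set js \<subseteq> {..<length v} \<Longrightarrow>
      concat (map (\<lambda>i. v ! i) is) = concat (map (\<lambda>j. v ! j) js) \<Longrightarrow> is = js" for "is" js
  proof (induction "is" arbitrary: js)
    case Nil
    then show ?case by (cases js) (auto simp: ne)
  next
    case (Cons i "is")
    then obtain j js' where js: "js = j # js'"
      by (cases js) (auto simp: ne)
    have "prefix (v ! i) (v ! j) \<or> prefix (v ! j) (v ! i)"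
    proof (rule prefix_same_cases)
      show "prefix (v ! i) (concat (map (\<lambda>i. v ! i) (i # is)))"
        by simp
      show "prefix (v ! j) (concat (map (\<lambda>i. v ! i) (i # is)))"
        unfolding Cons.prems(3) js by simp
    qed
    then have "i = j"
      using assms Cons.prems js unfolding prefix_code_def by auto
    then show ?case
      using Cons js by auto
  qed
  then show ?thesis
    unfolding uniquely_decodable_def by blast
qed

lemma PR_subset_UD: "PR X L \<subseteq> UD X L"
  by (auto simp: PR_def UD_def prefix_code_imp_uniquely_decodable)

end

theory Submission
  imports Defs
begin

text \<open>
  Take \<open>m - 1\<close> distinct words of length \<open>k = \<lceil>log\<^sub>n m\<rceil>\<close> and one further word \<open>w\<close> of length \<open>k * c\<close>.
  Since \<open>m - 1 < n ^ k\<close>, almost every \<open>w\<close> has, for large \<open>c\<close>, a \<open>k\<close>-block outside the short words.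
  In that case the code is uniquely decodable: the first block of a message that is not a short word
  determines where \<open>w\<close> first occurs. The code is a prefix code only if the first block of \<open>w\<close> is not a
  short word, which has probability \<open>1 - (m - 1) / n ^ k\<close>. Let \<open>c\<close> tend to infinity.
\<close>

section \<open>Words of a fixed length and lists of distinct words\<close>

definition words :: "'a set \<Rightarrow> nat \<Rightarrow> 'a list set" where
  "words X k = {w. set w \<subseteq> X \<and> length w = k}"

text \<open>Lists rather than subsets, since a code is a sequence. The number of these lists is
  never computed: it is a common factor of both counts below and cancels in the ratio.\<close>

definition distinct_lists :: "'b set \<Rightarrow> nat \<Rightarrow> 'b list set" where
  "distinct_lists W r = {u. length u = r \<and> distinct u \<and> set u \<subseteq> W}"

lemma finite_words: "finite X \<Longrightarrow> finite (words X k)"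
  unfolding words_def by (rule finite_lists_length_eq)

lemma card_words: "finite X \<Longrightarrow> card (words X k) = card X ^ k"
  unfolding words_def by (rule card_lists_length_eq)

lemma finite_distinct_lists:
  assumes "finite W"
  shows "finite (distinct_lists W r)"
  by (rule finite_subset[OF _ finite_lists_length_eq[OF assms, of r]])
     (auto simp: distinct_lists_def)

lemma distinct_lists_nonempty:
  assumes "finite W" "r \<le> card W"
  shows "distinct_lists W r \<noteq> {}"
proof -
  obtain S where S: "S \<subseteq> W" "card S = r" "finite S"
    using obtain_subset_with_card_n[OF assms(2)] by blast
  obtain u where "set u = S" "distinct u"
    using finite_distinct_list[OF S(3)] by blast
  then have "u \<in> distinct_lists W r"
    using S by (auto simp: distinct_lists_def distinct_card[symmetric])
  then show ?thesis by blast
qed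

section \<open>Unique decodability of codes with a single long word\<close>

lemma codes_replicate_snoc_iff:
  "u @ [w] \<in> codes X (replicate r k @ [q]) \<longleftrightarrow>
     length u = r \<and> set u \<subseteq> words X k \<and> w \<in> words X q"
proof
  assume *: "u @ [w] \<in> codes X (replicate r k @ [q])"
  then have u: "length u = r" by (simp add: codes_def)
  have i: "(u @ [w]) ! i \<in> lists X \<and> length ((u @ [w]) ! i) = (replicate r k @ [q]) ! i"
    if "i \<le> r" for i
    using * that by (simp add: codes_def)
  have "u ! i \<in> words X k" if "i < r" for i
    using i[of i] that u by (auto simp: words_def nth_append)
  then have "set u \<subseteq> words X k"
    using u by (auto simp: in_set_conv_nth)
  moreover have "w \<in> words X q"
    using i[of r] u by (auto simp: words_def nth_append)
  ultimately show "length u = r \<and> set u \<subseteq> words X k \<and> w \<in> words X q"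
    using u by blast
next
  assume *: "length u = r \<and> set u \<subseteq> words X k \<and> w \<in> words X q"
  then have "u ! i \<in> words X k" if "i < r" for i
    using that nth_mem by blast
  then show "u @ [w] \<in> codes X (replicate r k @ [q])"
    using * by (auto simp: codes_def words_def nth_append in_lists_conv_set subset_iff)
qed

text \<open>Words of \<open>C\<close> at the front of the message are split off one by one. When
  \<open>w\<close> comes up, what is left of \<open>z\<close> has fewer than
  \<open>q \<le> c\<close> blocks, so it lies inside \<open>w\<close> and \<open>pre\<close>
  decomposes it. This is the induction step for \<open>prefix_shifted_message\<close>.\<close>

lemma aligned_prefix_concat:
  assumes C: "\<And>x. x \<in> C \<Longrightarrow> length x = k"
    and w: "length w = k * c"
    and pre: "\<And>y t. t < q \<Longrightarrow> prefix y w \<Longrightarrow> length y = k * t \<Longrightarrow> y \<in> concat ` lists C"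
    and "q \<le> c" "t < q" "set xs \<subseteq> insert w C" "prefix z (concat xs)" "length z = k * t"
  shows "z \<in> concat ` lists C"
  using assms(5-)
proof (induction xs arbitrary: z t)
  case Nil
  then show ?case by (auto intro!: image_eqI[of _ _ "[]"])
next
  case (Cons x xs)
  consider "t = 0" | "t \<noteq> 0" "x = w" | t' where "t = Suc t'" "x \<in> C"
    using Cons.prems(2) by (cases t) auto
  then show ?case
  proof cases
    case 1
    then show ?thesis using Cons.prems by (auto intro!: image_eqI[of _ _ "[]"])
  next
    case 2
    have "length z \<le> length w"
      using Cons.prems \<open>q \<le> c\<close> w by simp
    then have "prefix z w"
      using Cons.prems(3) 2 by (auto intro: prefix_length_prefix)
    then show ?thesis using pre Cons.prems by blast
  next
    case 3
    then have lx: "length x = k" by (simp add: C)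
    then have "prefix x z"
      using Cons.prems 3 by (auto intro: prefix_length_prefix[of x "x @ concat xs"])
    then obtain z' where z: "z = x @ z'" by (auto simp: prefix_def)
    have "z' \<in> concat ` lists C"
      using Cons.IH[of t' z'] Cons.prems 3 z lx by auto
    then obtain bs where "bs \<in> lists C" "z' = concat bs" by blast
    then show ?thesis
      using z 3 by (intro image_eqI[of _ _ "x # bs"]) auto
  qed
qed

text \<open>The leading \<open>x\<close> shifts the message by one block. A copy of \<open>w\<close>
  in \<open>xs\<close> therefore starts at least one block into the prefix of \<open>w\<close> under
  consideration, and the part of that prefix which it covers is a shorter prefix of
  \<open>w\<close>. Strong induction on the number of blocks applies.\<close>

lemma prefix_shifted_message:
  assumes C: "\<And>x. x \<in> C \<Longrightarrow> length x = k"
    and w: "length w = k * c"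
    and x: "x \<in> C" and xs: "set xs \<subseteq> insert w C"
    and pre: "prefix w (x @ concat xs)"
  shows "w \<in> concat ` lists C"
proof -
  \<comment> \<open>The claim is generalised to all prefixes made of whole blocks; \<open>w\<close>
    itself is the case \<open>q = c\<close>.\<close>
  have "y \<in> concat ` lists C" if "q \<le> c" "prefix y w" "length y = k * q" for y q
    using that
  proof (induction q arbitrary: y rule: less_induct)
    case (less q)
    show ?case
    proof (cases q)
      case 0
      then show ?thesis using less.prems by (auto intro!: image_eqI[of _ _ "[]"])
    next
      case (Suc t)
      have y: "prefix y (x @ concat xs)"
        using less.prems(2) pre by (rule prefix_order.trans)
      then have "prefix x y"
        using less.prems Suc C[OF x] by (auto intro: prefix_length_prefix[of x "x @ concat xs"])
      then obtain z where z: "y = x @ z" by (auto simp: prefix_def)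
      have "z \<in> concat ` lists C"
      proof (rule aligned_prefix_concat[OF C w])
        show "y \<in> concat ` lists C" if "t < q" "prefix y w" "length y = k * t" for y t
          using less.IH[of t y] that less.prems(1) by simp
        show "q \<le> c" "t < q" "set xs \<subseteq> insert w C"
          using less.prems Suc xs by auto
        show "prefix z (concat xs)" "length z = k * t"
          using y z less.prems(3) Suc C[OF x] by auto
      qed auto
      then obtain bs where "bs \<in> lists C" "z = concat bs" by blast
      then show ?thesis
        using z x by (intro image_eqI[of _ _ "x # bs"]) auto
    qed
  qed
  then show ?thesis using w by blast
qed

text \<open>Compare the first words of two equal messages. Two entries of \<open>u\<close> have
  equal length, so they coincide, and \<open>u\<close> is distinct. An entry of \<open>u\<close>
  against \<open>w\<close> would turn \<open>w\<close> into a concatenation of entries of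
  \<open>u\<close>, by \<open>prefix_shifted_message\<close>. So the first indices agree and can be
  cancelled.\<close>

lemma uniquely_decodable_snoc:
  assumes u: "distinct u" "\<And>x. x \<in> set u \<Longrightarrow> length x = k"
    and w: "length w = k * c" "w \<notin> concat ` lists (set u)"
    and k: "k > 0"
  shows "uniquely_decodable (u @ [w])"
proof -
  let ?v = "u @ [w]"
  \<comment> \<open>The empty word is the concatenation of no words, so the hypothesis on
    \<open>w\<close> excludes it.\<close>
  have wne: "w \<noteq> []"
    using w(2) image_eqI[of "[]" concat "[]" "lists (set u)"] by auto
  have ne: "?v ! i \<noteq> []" if "i < length ?v" for i
    using nth_mem[OF that] u(2) k wne by auto
  have sub: "set (map ((!) ?v) xs) \<subseteq> insert w (set u)" if "set xs \<subseteq> {..<length ?v}" for xs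
  proof
    fix y assume "y \<in> set (map ((!) ?v) xs)"
    then have "y \<in> set ?v" using that by (auto intro!: nth_mem simp del: set_append)
    then show "y \<in> insert w (set u)" by simp
  qed
  have clash: False
    if "i < length u" "set xs \<subseteq> {..<length ?v}"
      "w @ a = u ! i @ concat (map ((!) ?v) xs)" for i xs a
    using prefix_shifted_message[OF u(2) w(1) nth_mem[OF that(1)] sub[OF that(2)]] that(3) w(2)
    by (metis prefixI)
  have "set is \<subseteq> {..<length ?v} \<Longrightarrow> set js \<subseteq> {..<length ?v} \<Longrightarrow>
      concat (map ((!) ?v) is) = concat (map ((!) ?v) js) \<Longrightarrow> is = js" for "is" js
  proof (induction "is" arbitrary: js)
    case Nil
    then show ?case using ne by (cases js) auto
  next
    case (Cons i "is")
    then obtain j js' where js: "js = j # js'"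
      using ne by (cases js) auto
    have eq: "?v ! i @ concat (map ((!) ?v) is) = ?v ! j @ concat (map ((!) ?v) js')"
      using Cons.prems js by simp
    have ij: "i \<le> length u" "j \<le> length u" using Cons.prems js by auto
    have "i = j"
    proof (cases "i < length u"; cases "j < length u")
      assume *: "i < length u" "j < length u"
      then have "u ! i = u ! j"
        using eq u(2)[of "u ! i"] u(2)[of "u ! j"] by (auto simp: nth_append)
      then show ?thesis using * u(1) nth_eq_iff_index_eq by blast
    next
      assume *: "i < length u" "\<not> j < length u"
      then have "j = length u" using ij by simp
      then show ?thesis
        using * clash[of i "is"] eq Cons.prems(1)
        by (metis list.set_intros(2) nth_append nth_append_length subset_iff)
    next
      assume *: "\<not> i < length u" "j < length u"
      then have "i = length u" using ij by simp
      then show ?thesis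
        using * clash[of j js'] eq Cons.prems(2) js
        by (metis list.set_intros(2) nth_append nth_append_length subset_iff)
    qed (use ij in auto)
    then show ?case using Cons.IH[of js'] Cons.prems js by auto
  qed
  then show ?thesis
    unfolding uniquely_decodable_def by blast
qed

section \<open>Counting uniquely decodable codes and prefix codes\<close>

context
  fixes X :: "'a set" and k r c :: nat
  assumes X: "finite X" and k: "k > 0"
begin

text \<open>Each choice \<open>u\<close> of short words spoils at most \<open>r ^ c\<close> long
  words, namely the concatenations of \<open>c\<close> entries of \<open>u\<close>; every other long
  word completes \<open>u\<close> to a uniquely decodable code.\<close>

lemma card_UD_ge:
  "card (distinct_lists (words X k) r) * (card X ^ (k * c) - r ^ c)
     \<le> card (UD X (replicate r k @ [k * c]))"
proof -
  let ?A = "distinct_lists (words X k) r" and ?L = "replicate r k @ [k * c]"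
  let ?B = "\<lambda>u. concat ` {bs. set bs \<subseteq> set u \<and> length bs = c}"
  let ?S = "SIGMA u:?A. words X (k * c) - ?B u"
  have good: "u @ [w] \<in> UD X ?L" if "u \<in> ?A" "w \<in> words X (k * c) - ?B u" for u w
  proof -
    have u: "length u = r" "distinct u" "set u \<subseteq> words X k"
      using that(1) by (auto simp: distinct_lists_def)
    have len: "length x = k" if "x \<in> set u" for x
      using u that by (auto simp: words_def)
    have "w \<notin> concat ` lists (set u)"
    proof
      assume "w \<in> concat ` lists (set u)"
      then obtain bs where bs: "set bs \<subseteq> set u" "w = concat bs"
        by (auto simp: in_lists_conv_set)
      \<comment> \<open>Comparing lengths forces exactly \<open>c\<close> factors, so the finite set
        \<open>?B u\<close> already contains every decomposable word of length
        \<open>k * c\<close>.\<close>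
      then have "length w = k * length bs"
        using len by (induction bs arbitrary: w) auto
      then have "length bs = c" using that(2) k by (auto simp: words_def)
      then show False using bs that(2) by blast
    qed
    then have "uniquely_decodable (u @ [w])"
      using that u len k by (intro uniquely_decodable_snoc[of u k w c]) (auto simp: words_def)
    then show ?thesis
      using u that(2) by (simp add: UD_def codes_replicate_snoc_iff)
  qed
  have fin: "finite ?A"
    by (intro finite_distinct_lists finite_words X)
  have "card X ^ (k * c) - r ^ c \<le> card (words X (k * c) - ?B u)" if "u \<in> ?A" for u
  proof -
    have "card (set u) = r" using that by (auto simp: distinct_lists_def distinct_card)
    then have "card (?B u) \<le> r ^ c"
      using card_image_le[OF finite_lists_length_eq[of "set u" c], of concat]
      by (simp add: card_lists_length_eq)
    then have "card X ^ (k * c) - r ^ c \<le> card (words X (k * c)) - card (?B u)"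
      by (simp add: card_words X)
    also have "\<dots> \<le> card (words X (k * c) - ?B u)"
      by (intro diff_card_le_card_Diff finite_imageI finite_lists_length_eq) simp
    finally show ?thesis .
  qed
  then have "card ?A * (card X ^ (k * c) - r ^ c) \<le> (\<Sum>u\<in>?A. card (words X (k * c) - ?B u))"
    using sum_bounded_below[of ?A "card X ^ (k * c) - r ^ c"] by simp
  also have "\<dots> = card ?S"
    using fin finite_words[OF X] by (simp add: card_SigmaI)
  also have "\<dots> \<le> card (UD X ?L)"
  proof (rule card_inj_on_le)
    show "inj_on (\<lambda>(u, w). u @ [w]) ?S" by (auto simp: inj_on_def)
    show "(\<lambda>(u, w). u @ [w]) ` ?S \<subseteq> UD X ?L" using good by auto
    show "finite (UD X ?L)"
      by (rule finite_subset[OF _ finite_codes[OF X]]) (auto simp: UD_def)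
  qed
  finally show ?thesis .
qed

text \<open>In a prefix code the first block of the long word must avoid \<open>u\<close>, which
  leaves \<open>card X ^ k - r\<close> choices; the other \<open>c\<close> blocks are bounded by all
  words. The length \<open>k * Suc c\<close> guarantees that a first block exists.\<close>

lemma card_PR_le:
  "card (PR X (replicate r k @ [k * Suc c]))
     \<le> card (distinct_lists (words X k) r) * ((card X ^ k - r) * card X ^ (k * c))"
proof -
  let ?A = "distinct_lists (words X k) r" and ?L = "replicate r k @ [k * Suc c]"
  let ?S = "SIGMA u:?A. (words X k - set u) \<times> words X (k * c)"
  let ?f = "\<lambda>(u, a, b). u @ [a @ b]"
  have fin: "finite ?A" "finite ?S"
    by (auto intro!: finite_SigmaI finite_distinct_lists finite_words X)
  have "PR X ?L \<subseteq> ?f ` ?S"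
  proof
    fix v assume v: "v \<in> PR X ?L"
    then have "length v = Suc r" by (simp add: PR_def codes_def)
    then obtain u w where vw: "v = u @ [w]"
      by (metis Zero_not_Suc list.size(3) rev_exhaust)
    have u: "length u = r" "set u \<subseteq> words X k" "w \<in> words X (k * Suc c)"
      using v unfolding vw PR_def by (auto simp: codes_replicate_snoc_iff)
    have p: "prefix_code (u @ [w])" using v by (simp add: PR_def vw)
    then have "u \<in> ?A" using u by (auto simp: distinct_lists_def prefix_code_def)
    moreover have "take k w \<notin> set u"
    proof
      assume "take k w \<in> set u"
      then obtain i where "i < length u" "u ! i = take k w" by (auto simp: in_set_conv_nth)
      then have "prefix ((u @ [w]) ! i) ((u @ [w]) ! length u)"
        by (simp add: nth_append take_is_prefix)
      moreover have "i < length (u @ [w])" "length u < length (u @ [w])" "i \<noteq> length u"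
        using \<open>i < length u\<close> by auto
      ultimately show False using p unfolding prefix_code_def by blast
    qed
    moreover have "take k w \<in> words X k" "drop k w \<in> words X (k * c)"
      using u(3) set_take_subset[of k w] set_drop_subset[of k w] by (auto simp: words_def)
    ultimately show "v \<in> ?f ` ?S"
      by (intro image_eqI[of _ _ "(u, take k w, drop k w)"]) (auto simp: vw)
  qed
  then have "card (PR X ?L) \<le> card (?f ` ?S)"
    using fin by (intro card_mono) auto
  also have "\<dots> \<le> card ?S" using fin by (intro card_image_le)
  also have "\<dots> = (\<Sum>u\<in>?A. card ((words X k - set u) \<times> words X (k * c)))"
    using fin by (intro card_SigmaI) (auto intro!: finite_words X)
  also have "\<dots> = (\<Sum>u\<in>?A. (card X ^ k - r) * card X ^ (k * c))"
    by (intro sum.cong)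
       (auto simp: distinct_lists_def card_Diff_subset distinct_card card_cartesian_product
          card_words X)
  finally show ?thesis by simp
qed

end

section \<open>Bounding the infimum and passing to the limit\<close>

lemma xi_le_ratio:
  assumes X: "finite X" and k: "k > 0" and r: "r < card X ^ k"
  shows "xi X (Suc r) \<le> (1 - real r / real (card X ^ k)) / (1 - (real r / real (card X ^ k)) ^ Suc c)"
proof -
  define N where "N = card X ^ k"
  define A where "A = card (distinct_lists (words X k) r)"
  define L where "L = replicate r k @ [k * Suc c]"
  have N: "r < N" "N > 0" using r unfolding N_def by linarith+
  have "A > 0"
    unfolding A_def card_gt_0_iff
    using distinct_lists_nonempty[OF finite_words[OF X]] finite_distinct_lists[OF finite_words[OF X]] r
    by (simp add: card_words X)
  have rN: "r ^ Suc c < N ^ Suc c" using N by (intro power_strict_mono) auto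
  have ud: "A * (N ^ Suc c - r ^ Suc c) \<le> card (UD X L)"
    using card_UD_ge[OF X k, of r "Suc c"] by (simp only: A_def N_def L_def power_mult)
  have pr: "card (PR X L) \<le> A * ((N - r) * N ^ c)"
    using card_PR_le[OF X k, of r c] by (simp only: A_def N_def L_def power_mult)
  have "0 < A * (N ^ Suc c - r ^ Suc c)" using \<open>A > 0\<close> rN by simp
  \<comment> \<open>The lower bound on the count is positive, so \<open>L\<close> takes part in the
    infimum.\<close>
  then have "UD X L \<noteq> {}" using ud by (metis card.empty not_le)
  then have "L \<in> length_dists X (Suc r)" using k by (auto simp: length_dists_def L_def)
  then have "xi X (Suc r) \<le> real (card (PR X L)) / real (card (UD X L))"
    \<comment> \<open>An infimum of reals lies below its members only if they are bounded below;
      here 0 is a bound.\<close>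
    unfolding xi_def by (intro cINF_lower) (auto intro!: bdd_belowI[of _ 0])
  also have "\<dots> \<le> real (A * ((N - r) * N ^ c)) / real (A * (N ^ Suc c - r ^ Suc c))"
    using pr ud \<open>0 < A * (N ^ Suc c - r ^ Suc c)\<close>
    by (intro frac_le) (simp_all only: of_nat_le_iff of_nat_0_less_iff of_nat_0_le_iff)
  \<comment> \<open>The factor \<open>A\<close> cancels; dividing both sides of the fraction by
    \<open>N ^ Suc c\<close> then leaves an expression in \<open>r / N\<close> alone.\<close>
  also have "\<dots> = ((real N - real r) * real N ^ c) / (real N ^ Suc c - real r ^ Suc c)"
    using \<open>A > 0\<close> N rN by (simp add: of_nat_diff less_imp_le del: power_Suc)
  also have "\<dots> = ((real N - real r) * real N ^ c / real N ^ Suc c)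
      / ((real N ^ Suc c - real r ^ Suc c) / real N ^ Suc c)"
    using N by simp
  also have "(real N - real r) * real N ^ c / real N ^ Suc c = 1 - real r / real N"
    using N by (simp add: field_simps)
  also have "(real N ^ Suc c - real r ^ Suc c) / real N ^ Suc c = 1 - (real r / real N) ^ Suc c"
    using N by (simp add: diff_divide_distrib power_divide del: power_Suc)
  finally show ?thesis by (simp only: N_def)
qed

lemma xi_le:
  assumes "finite X" and "k > 0" and r: "r < card X ^ k"
  shows "xi X (Suc r) \<le> 1 - real r / real (card X ^ k)"
proof -
  define T where "T = real r / real (card X ^ k)"
  have "real r < real (card X ^ k)" using r by (simp only: of_nat_less_iff)
  then have T: "0 \<le> T" "T < 1" by (auto simp: T_def divide_less_eq)
  then have "(\<lambda>c. (1 - T) / (1 - T ^ Suc c)) \<longlonglongrightarrow> (1 - T) / (1 - 0)"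
    by (intro tendsto_intros LIMSEQ_Suc LIMSEQ_realpow_zero) auto
  \<comment> \<open>\<open>xi\<close> does not depend on \<open>c\<close>, so the bound survives the
    limit.\<close>
  then show ?thesis
    using xi_le_ratio[OF assms] by (auto intro!: LIMSEQ_le_const simp: T_def)
qed

theorem theorem4:
  fixes X :: "'a set" and n m :: nat
  assumes "finite X" and "card X = n" and "n \<ge> 2" and "m \<ge> 1"
  shows "xi X m \<le> 1 - (real m - 1) / real n ^ nat \<lceil>log (real n) (real m)\<rceil>"
proof (cases "m = 1")
  case True
  \<comment> \<open>Here the logarithm gives block length 0, which \<open>xi_le\<close> excludes. As
    \<open>m - 1 = 0\<close>, the subtracted fraction vanishes for every block length, and length 1
    serves.\<close>
  then show ?thesis using xi_le[of X 1 0] assms by simp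
next
  case False
  define k where "k = nat \<lceil>log (real n) (real m)\<rceil>"
  have "log (real n) (real m) > 0" using False assms by simp
  then have k: "k > 0" "log (real n) (real m) \<le> real k"
    unfolding k_def by linarith+
  have "real m = real n powr log (real n) (real m)" using assms by simp
  also have "\<dots> \<le> real n powr real k" using assms k by (intro powr_mono) auto
  also have "\<dots> = real (n ^ k)" using assms by (simp add: powr_realpow)
  \<comment> \<open>This yields \<open>m - 1 < n ^ k\<close>, the condition of \<open>xi_le\<close>
    for \<open>r = m - 1\<close> short words.\<close>
  finally have "m \<le> n ^ k" by (simp only: of_nat_le_iff)
  then have "xi X (Suc (m - 1)) \<le> 1 - real (m - 1) / real (card X ^ k)"
    using assms k by (intro xi_le) auto
  then show ?thesis using assms by (simp add: k_def of_nat_diff)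
qed

end
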